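(* Let $A$ be an Artinian ring. Then $A$ is not a proper union of additive subgroups if and only if the additive group of $A$ is (isomorphic to) a direct sum of a divisible abelian group and a finite cyclic group.
   Context: Rings are associative and are not assumed to have an identity element; an Artinian ring is a ring satisfying the minimal condition (descending chain condition) on left ideals. A set $S$ is said to be the proper union of the sets $S_1,\ldots,S_n$ ($n\ge 2$ a finite integer) if $\bigcup_{i=1}^n S_i=S$ and $\bigcup_{i\neq k}S_i\neq S$ for every $k=1,\ldots,n$. "$A$ is a proper union of additive subgroups" means that there are $n\ge 2$ and subgroups $S_1,\ldots,S_n$ of the additive group of $A$ such that $A$ is the proper union of $S_1,\ldots,S_n$. The trivial group counts as a divisible group and as a finite cyclic group. *)

theory Defs
  imports "HOL-Algebra.Algebra"
begin

(* The ring locale of HOL-Algebra has a unit.  Here no axiom constrains the field "one" of the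
   record, so it carries no information. *)
locale nonunital_ring = abelian_group R for R (structure) +
  assumes m_closed: "\<lbrakk>x \<in> carrier R; y \<in> carrier R\<rbrakk> \<Longrightarrow> x \<otimes> y \<in> carrier R"
    and m_assoc: "\<lbrakk>x \<in> carrier R; y \<in> carrier R; z \<in> carrier R\<rbrakk>
           \<Longrightarrow> (x \<otimes> y) \<otimes> z = x \<otimes> (y \<otimes> z)"
    and l_distr: "\<lbrakk>x \<in> carrier R; y \<in> carrier R; z \<in> carrier R\<rbrakk>
           \<Longrightarrow> (x \<oplus> y) \<otimes> z = x \<otimes> z \<oplus> y \<otimes> z"
    and r_distr: "\<lbrakk>x \<in> carrier R; y \<in> carrier R; z \<in> carrier R\<rbrakk>
           \<Longrightarrow> z \<otimes> (x \<oplus> y) = z \<otimes> x \<oplus> z \<otimes> y"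

definition left_ideal :: "'a set \<Rightarrow> ('a, 'b) ring_scheme \<Rightarrow> bool" where
  "left_ideal I R \<longleftrightarrow>
     additive_subgroup I R \<and> (\<forall>r\<in>carrier R. \<forall>x\<in>I. r \<otimes>\<^bsub>R\<^esub> x \<in> I)"

locale artinian_ring = nonunital_ring R for R (structure) +
  assumes descending_chain_condition:
    "\<lbrakk>\<And>n::nat. left_ideal (I n) R; \<And>n. I (Suc n) \<subseteq> I n\<rbrakk> \<Longrightarrow> \<exists>N. \<forall>n\<ge>N. I n = I N"

definition is_proper_union :: "'a set \<Rightarrow> nat \<Rightarrow> (nat \<Rightarrow> 'a set) \<Rightarrow> bool" where
  "is_proper_union S n T \<longleftrightarrow>
     n \<ge> 2 \<and> (\<Union>i\<in>{1..n}. T i) = S \<and> (\<forall>k\<in>{1..n}. (\<Union>i\<in>{1..n} - {k}. T i) \<noteq> S)"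

definition proper_union_of_additive_subgroups :: "('a, 'b) ring_scheme \<Rightarrow> bool" where
  "proper_union_of_additive_subgroups R \<longleftrightarrow>
     (\<exists>n T. (\<forall>i\<in>{1..n}. additive_subgroup (T i) R) \<and> is_proper_union (carrier R) n T)"

(* Groups are written multiplicatively, so the n-th multiple of y is y [^] n. *)
definition divisible_group :: "('a, 'b) monoid_scheme \<Rightarrow> bool" where
  "divisible_group G \<longleftrightarrow>
     comm_group G \<and>
     (\<forall>x\<in>carrier G. \<forall>n::nat. n > 0 \<longrightarrow> (\<exists>y\<in>carrier G. y [^]\<^bsub>G\<^esub> n = x))"

(* Taking the summands over the element type of G loses no generality: in any isomorphism of G with
   a direct sum, both summands are isomorphic to subgroups of G. *)
definition divisible_plus_finite_cyclic :: "('a, 'b) monoid_scheme \<Rightarrow> bool" where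
  "divisible_plus_finite_cyclic G \<longleftrightarrow>
     (\<exists>(D :: 'a monoid) (C :: 'a monoid).
        divisible_group D \<and> group C \<and> cyclic_group C \<and> finite (carrier C) \<and> G \<cong> D \<times>\<times> C)"

end

theory Submission
  imports Defs
begin

text \<open>
  Removing superfluous members from a finite cover by proper subgroups makes it irredundant, so the
  question is whether the additive group \<open>G\<close> of the ring is covered by finitely many proper
  subgroups.

  If \<open>G = D \<times> C\<close> with \<open>D\<close> divisible and \<open>c\<close> a generator of \<open>C\<close>, look at how a finite cover by
  subgroups meets the coset \<open>D \<times> {c}\<close>: each member meets it in nothing or in a coset of a subgroup of
  \<open>D\<close>. By B. H. Neumann's theorem a finite cover by cosets involves a subgroup of finite index, and a
  divisible group has no such subgroup except itself (\<open>divisible_group_coset_cover\<close>). So one member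
  contains all of \<open>D \<times> {c}\<close>, and then all of \<open>G\<close>.

  Conversely, suppose that \<open>G\<close> has no finite cover by proper subgroups. The multiples \<open>n! G\<close> form a
  descending chain of left ideals, so \<open>D = N G\<close> is divisible for some factorial \<open>N\<close>. For a prime
  \<open>p\<close> the quotient \<open>G/pG\<close> is a vector space over the field with \<open>p\<close> elements. If its dimension were at
  least 2, it would map onto a plane, which is the union of its \<open>p + 1\<close> lines
  (\<open>elementary_abelian_cover\<close>), and this cover would pull back to \<open>G\<close>. So \<open>G/pG\<close> is generated by
  any of its nonzero elements. As \<open>G\<close> is not the finite union of those \<open>pG\<close>, \<open>p \<le> N\<close>, that are
  proper, one element \<open>b\<close> generates all these quotients at once. Working through the prime factors of
  \<open>N\<close> yields \<open>G = \<langle>b\<rangle> + NG\<close> (\<open>cyclic_modulo_powers\<close>). Finally the finite cyclic quotient \<open>G/D\<close> lifts: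
  if \<open>m\<close> is the order of \<open>b\<close> modulo \<open>D\<close>, subtract from \<open>b\<close> an \<open>m\<close>-th part of \<open>m b\<close> in \<open>D\<close>
  (\<open>divisible_plus_finite_cyclicI\<close>).

  Abelian groups are written multiplicatively until they become additive groups of rings.
\<close>

section \<open>Finite covers by proper subgroups\<close>

definition finite_proper_cover :: "('a, 'b) monoid_scheme \<Rightarrow> 'a set set \<Rightarrow> bool" where
  "finite_proper_cover G \<F> \<longleftrightarrow>
     finite \<F> \<and> (\<forall>H\<in>\<F>. subgroup H G \<and> H \<noteq> carrier G) \<and> carrier G \<subseteq> \<Union>\<F>"

text \<open>
  A member of an irredundant union with at least two members cannot be the whole set, since the
  others would be superfluous. Conversely, a cover of least cardinality is irredundant, and it has at
  least two members because they are proper.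
\<close>

lemma proper_union_iff_finite_proper_cover:
  assumes "group (add_monoid A)"
  shows "proper_union_of_additive_subgroups A \<longleftrightarrow> (\<exists>\<F>. finite_proper_cover (add_monoid A) \<F>)"
proof
  assume "proper_union_of_additive_subgroups A"
  then obtain n T where sub: "\<forall>i\<in>{1..n}. additive_subgroup (T i) A"
    and T: "is_proper_union (carrier A) n T"
    by (auto simp: proper_union_of_additive_subgroups_def)
  have n: "n \<ge> 2" and un: "(\<Union>i\<in>{1..n}. T i) = carrier A"
    and irr: "\<And>k. k \<in> {1..n} \<Longrightarrow> (\<Union>i\<in>{1..n} - {k}. T i) \<noteq> carrier A"
    using T unfolding is_proper_union_def by auto
  have "T i \<noteq> carrier A" if i: "i \<in> {1..n}" for i
  proof
    assume full: "T i = carrier A"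
    obtain k where k: "k \<in> {1..n}" "k \<noteq> i"
      using n by (metis One_nat_def Suc_1 atLeastAtMost_iff i le_antisym le_refl nat_le_linear
          not_less_eq_eq numeral_2_eq_2 order_trans)
    have "(\<Union>j\<in>{1..n} - {k}. T j) = carrier A"
      using full un i k by fast
    then show False using irr k by blast
  qed
  then have "finite_proper_cover (add_monoid A) (T ` {1..n})"
    using sub un unfolding finite_proper_cover_def additive_subgroup_def by auto
  then show "\<exists>\<F>. finite_proper_cover (add_monoid A) \<F>" by blast
next
  interpret group "add_monoid A" by fact
  assume "\<exists>\<F>. finite_proper_cover (add_monoid A) \<F>"
  then obtain \<F> where \<F>: "finite_proper_cover (add_monoid A) \<F>"
    and least: "\<And>\<G>. finite_proper_cover (add_monoid A) \<G> \<Longrightarrow> card \<F> \<le> card \<G>"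
    using exists_least_iff[of "\<lambda>m. \<exists>\<F>. finite_proper_cover (add_monoid A) \<F> \<and> card \<F> = m"]
    by (metis not_le)
  have fin: "finite \<F>" and proper: "\<And>H. H \<in> \<F> \<Longrightarrow> subgroup H (add_monoid A) \<and> H \<noteq> carrier A"
    and un: "\<Union>\<F> = carrier A"
    using \<F> subgroup.subset unfolding finite_proper_cover_def by fastforce+
  have irr: "\<Union>(\<F> - {H}) \<noteq> carrier A" if "H \<in> \<F>" for H
  proof
    assume "\<Union>(\<F> - {H}) = carrier A"
    then have "finite_proper_cover (add_monoid A) (\<F> - {H})"
      using fin proper unfolding finite_proper_cover_def by auto
    from least[OF this] show False
      using fin that by (meson card_Diff1_less not_le)
  qed
  have "\<F> \<noteq> {}" using un one_closed by auto
  moreover have "\<F> \<noteq> {H}" for H using un proper by auto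
  ultimately have "card \<F> \<noteq> 0" "card \<F> \<noteq> 1"
    using fin by (auto simp: card_1_singleton_iff)
  then have n: "card \<F> \<ge> 2" by linarith
  obtain T where T: "bij_betw T {1..card \<F>} \<F>"
    using ex_bij_betw_nat_finite_1[OF fin] by blast
  have "T ` ({1..card \<F>} - {k}) = \<F> - {T k}" if "k \<in> {1..card \<F>}" for k
    using inj_on_image_set_diff[of T "{1..card \<F>}" "{1..card \<F>}" "{k}"] T that
    unfolding bij_betw_def by auto
  moreover have "T ` {1..card \<F>} = \<F>" using T by (simp add: bij_betw_def)
  ultimately have "is_proper_union (carrier A) (card \<F>) T"
    unfolding is_proper_union_def using n un irr by (metis imageI)
  moreover have "\<forall>i\<in>{1..card \<F>}. additive_subgroup (T i) A"
    using T proper unfolding bij_betw_def additive_subgroup_def by blast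
  ultimately show "proper_union_of_additive_subgroups A"
    unfolding proper_union_of_additive_subgroups_def by blast
qed

lemma (in group_hom) finite_proper_cover_vimage:
  assumes surj: "h ` carrier G = carrier H" and cover: "finite_proper_cover H \<F>"
  shows "finite_proper_cover G ((\<lambda>K. {x \<in> carrier G. h x \<in> K}) ` \<F>)"
proof -
  have "subgroup {x \<in> carrier G. h x \<in> K} G" if "subgroup K H" for K
  proof -
    interpret K: subgroup K H by fact
    show ?thesis
    proof (rule G.subgroupI)
      have "\<one> \<in> {x \<in> carrier G. h x \<in> K}" using K.one_closed by simp
      then show "{x \<in> carrier G. h x \<in> K} \<noteq> {}" by blast
    qed auto
  qed
  moreover have "{x \<in> carrier G. h x \<in> K} \<noteq> carrier G" if K: "subgroup K H" "K \<noteq> carrier H" for K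
  proof -
    obtain y where y: "y \<in> carrier H" "y \<notin> K" using K(2) subgroup.subset[OF K(1)] by auto
    then have "y \<in> h ` carrier G" using surj by simp
    then obtain x where "x \<in> carrier G" "h x \<notin> K" using y(2) by auto
    then show ?thesis by auto
  qed
  moreover have "carrier G \<subseteq> (\<Union>K\<in>\<F>. {x \<in> carrier G. h x \<in> K})"
  proof
    fix x assume x: "x \<in> carrier G"
    then have "h x \<in> \<Union>\<F>" using cover unfolding finite_proper_cover_def by (meson hom_closed subsetD)
    then show "x \<in> (\<Union>K\<in>\<F>. {x \<in> carrier G. h x \<in> K})" using x by simp
  qed
  ultimately show ?thesis
    using cover unfolding finite_proper_cover_def by simp
qed

section \<open>A divisible group times a cyclic group has no such cover\<close>

text \<open>
  By the pigeonhole principle two of the powers \<open>x^0, ..., x^|S|\<close> lie in the same coset of \<open>H\<close>, so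
  \<open>x^k\<close> lies in \<open>H\<close> for some positive \<open>k \<le> |S|\<close>, and hence so does \<open>x^|S|!\<close>. In a divisible group
  every element is such a power.
\<close>

lemma divisible_subgroup_finite_index:
  fixes G (structure)
  assumes D: "divisible_group G" and H: "subgroup H G"
    and fin: "finite S" and S: "S \<subseteq> carrier G" and cov: "carrier G \<subseteq> (\<Union>a\<in>S. H #> a)"
  shows "H = carrier G"
proof
  interpret comm_group G using D by (simp add: divisible_group_def)
  interpret H: subgroup H G by fact
  show "H \<subseteq> carrier G" by (rule H.subset)
  have pow: "x [^] (fact (card S) :: nat) \<in> H" if x: "x \<in> carrier G" for x
  proof -
    have "\<forall>k::nat. \<exists>a\<in>S. x [^] k \<in> H #> a" using cov x by blast
    then obtain f where f: "\<And>k::nat. f k \<in> S \<and> x [^] k \<in> H #> f k" by metis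
    have "\<not> inj_on f {..card S}"
      using card_inj_on_le[of f "{..card S}" S] f fin by auto
    then obtain i j where ij: "i < j" "j \<le> card S" "f i = f j"
      unfolding inj_on_def by (metis atMost_iff linorder_neqE_nat)
    obtain g h where gh: "g \<in> H" "h \<in> H" "x [^] j = g \<otimes> f i" "x [^] i = h \<otimes> f i"
      using f[of i] f[of j] ij(3) unfolding r_coset_def by auto
    moreover have "f i \<in> carrier G" using f S by blast
    ultimately have "x [^] j \<otimes> inv (x [^] i) = g \<otimes> inv h"
      by (simp add: inv_mult_group m_assoc) (simp flip: m_assoc)
    then have "x [^] j \<otimes> inv (x [^] i) \<in> H" using gh by simp
    moreover have "x [^] j = x [^] (j - i) \<otimes> x [^] i"
      using ij x by (simp add: nat_pow_mult)
    ultimately have *: "x [^] (j - i) \<in> H"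
      using x by (simp add: m_assoc)
    have "j - i dvd fact (card S)"
      using ij by (intro dvd_fact) auto
    then obtain q where "fact (card S) = (j - i) * q" by (elim dvdE)
    moreover have "(x [^] (j - i)) [^] q \<in> H"
      using * by (induction q) auto
    ultimately show ?thesis using x by (simp add: nat_pow_pow)
  qed
  show "carrier G \<subseteq> H"
  proof
    fix x assume "x \<in> carrier G"
    then obtain y where "y \<in> carrier G" "y [^] (fact (card S) :: nat) = x"
      using D unfolding divisible_group_def by (metis fact_gt_zero)
    then show "x \<in> H" using pow by blast
  qed
qed

text \<open>
  B. H. Neumann's theorem for divisible groups, by induction on the number of subgroups involved. If
  \<open>K\<close> is proper, finitely many of its cosets cannot cover, so some coset of \<open>K\<close> is disjoint from those
  in the cover and is therefore covered by the cosets of the other subgroups. Translates of these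
  replace every coset of \<open>K\<close> in the cover, and \<open>K\<close> is eliminated.
\<close>

lemma divisible_group_coset_cover:
  fixes G (structure)
  assumes D: "divisible_group G" and fin: "finite \<H>" and sub: "\<forall>H\<in>\<H>. subgroup H G"
    and finP: "finite P" and P: "P \<subseteq> carrier G \<times> \<H>"
    and cov: "carrier G \<subseteq> (\<Union>(a, H)\<in>P. H #> a)"
  shows "carrier G \<in> \<H>"
  using fin sub finP P cov
proof (induction \<H> arbitrary: P rule: finite_induct)
  case empty
  interpret comm_group G using D by (simp add: divisible_group_def)
  show ?case using empty one_closed by auto
next
  case (insert K \<H>)
  interpret comm_group G using D by (simp add: divisible_group_def)
  interpret K: subgroup K G using insert by simp
  define S where "S = {a. (a, K) \<in> P}"
  have "S \<subseteq> fst ` P" unfolding S_def by force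
  then have finS: "finite S" using insert.prems(2) by (meson finite_imageI finite_subset)
  have S: "S \<subseteq> carrier G" using insert.prems unfolding S_def by blast
  show ?case
  proof (cases "K = carrier G")
    case False
    then obtain b where b: "b \<in> carrier G" "b \<notin> (\<Union>a\<in>S. K #> a)"
      using divisible_subgroup_finite_index[OF D K.subgroup_axioms finS S] by blast
    define Q where "Q = {(a, H) \<in> P. H \<noteq> K}"
    \<comment> \<open>For \<open>s \<in> S\<close>, translation by \<open>b\<inverse> s\<close> carries the coset of \<open>b\<close> to that of \<open>s\<close>.\<close>
    define P' where "P' = Q \<union> (\<Union>s\<in>S. (\<lambda>(a, H). (a \<otimes> inv b \<otimes> s, H)) ` Q)"
    have Q: "Q \<subseteq> carrier G \<times> \<H>" using insert.prems unfolding Q_def by auto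
    have finQ: "finite Q" using insert.prems unfolding Q_def
      by (auto intro: finite_subset[of _ P])
    have coset_in_Q: "\<exists>(a, H)\<in>Q. k \<otimes> b \<in> H #> a" if k: "k \<in> K" for k
    proof -
      have kb: "k \<otimes> b \<in> carrier G" using k b by simp
      then obtain a H where aH: "(a, H) \<in> P" "k \<otimes> b \<in> H #> a"
        using insert.prems(4) by blast
      have "H \<noteq> K"
      proof
        assume "H = K"
        then have "a \<in> S" "k \<otimes> b \<in> K #> a" using aH unfolding S_def by auto
        then obtain k' where k': "k' \<in> K" "k \<otimes> b = k' \<otimes> a" unfolding r_coset_def by blast
        have "a \<in> carrier G" using S \<open>a \<in> S\<close> by blast
        then have "b = (inv k \<otimes> k') \<otimes> a"
          using k k' b by (metis K.mem_carrier inv_closed inv_solve_left m_assoc m_closed)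
        then have "b \<in> K #> a" using k k' unfolding r_coset_def by blast
        then show False using b \<open>a \<in> S\<close> by blast
      qed
      then show ?thesis using aH unfolding Q_def by blast
    qed
    have "carrier G \<subseteq> (\<Union>(a, H)\<in>P'. H #> a)"
    proof
      fix x assume x: "x \<in> carrier G"
      then obtain a H where aH: "(a, H) \<in> P" "x \<in> H #> a"
        using insert.prems(4) by blast
      show "x \<in> (\<Union>(a, H)\<in>P'. H #> a)"
      proof (cases "H = K")
        case True
        then have s: "a \<in> S" using aH S_def by auto
        then have ac: "a \<in> carrier G" using S by blast
        obtain k where k: "k \<in> K" "x = k \<otimes> a" using aH True by (auto simp: r_coset_def)
        obtain a' H' where a': "(a', H') \<in> Q" "k \<otimes> b \<in> H' #> a'" using coset_in_Q[OF k(1)] by blast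
        have H': "subgroup H' G" "a' \<in> carrier G" using Q a' insert.prems by auto
        obtain h where h: "h \<in> H'" "k \<otimes> b = h \<otimes> a'" using a' by (auto simp: r_coset_def)
        have hc: "h \<in> carrier G" using h H' subgroup.mem_carrier by metis
        have "x = (k \<otimes> b) \<otimes> (inv b \<otimes> a)" using k b ac
          by (metis K.mem_carrier inv_closed m_assoc m_closed r_inv r_one)
        also have "\<dots> = h \<otimes> (a' \<otimes> inv b \<otimes> a)" using h(2) hc H' b ac by (simp add: m_assoc)
        finally have "x \<in> H' #> (a' \<otimes> inv b \<otimes> a)" using h by (auto simp: r_coset_def)
        moreover have "(a' \<otimes> inv b \<otimes> a, H') \<in> P'" using a' s unfolding P'_def by force
        ultimately show ?thesis by blast
      next
        case False
        then have "(a, H) \<in> P'" using aH unfolding P'_def Q_def by blast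
        then show ?thesis using aH by blast
      qed
    qed
    moreover have "finite P'" using finQ finS unfolding P'_def by blast
    moreover have "P' \<subseteq> carrier G \<times> \<H>" using Q S b unfolding P'_def by fastforce
    ultimately have "carrier G \<in> \<H>" using insert by auto
    then show ?thesis by simp
  qed simp
qed

text \<open>
  A member \<open>T\<close> of the cover that contains \<open>(s, c)\<close> meets \<open>D \<times> {c}\<close> in the coset of
  \<open>{d. (d, 1) \<in> T}\<close> given by \<open>s\<close>. These cosets cover \<open>D\<close>, so for some \<open>T\<close> the subgroup is \<open>D\<close> itself.
\<close>

lemma no_finite_proper_cover_divisible_times_cyclic:
  assumes D: "divisible_group D" and C: "group C" "cyclic_group C"
  shows "\<not> finite_proper_cover (D \<times>\<times> C) \<F>"
proof
  assume cover: "finite_proper_cover (D \<times>\<times> C) \<F>"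
  interpret D: comm_group D using D by (simp add: divisible_group_def)
  interpret C: group C by fact
  interpret DC: group "D \<times>\<times> C" by (simp add: DirProd_group D.is_group C)
  obtain c where c: "c \<in> carrier C" "carrier C = range (\<lambda>k::int. c [^]\<^bsub>C\<^esub> k)"
    using C C.cyclic_group by blast
  define \<T> where "\<T> = {T \<in> \<F>. \<exists>d\<in>carrier D. (d, c) \<in> T}"
  define slice where "slice T = {d \<in> carrier D. (d, \<one>\<^bsub>C\<^esub>) \<in> T}" for T
  have sub: "subgroup T (D \<times>\<times> C)" if "T \<in> \<F>" for T
    using that cover unfolding finite_proper_cover_def by blast
  have fin: "finite \<T>" using cover unfolding finite_proper_cover_def \<T>_def by auto
  obtain s where s: "\<And>T. T \<in> \<T> \<Longrightarrow> s T \<in> carrier D \<and> (s T, c) \<in> T"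
  proof -
    have "\<forall>T. \<exists>d. T \<in> \<T> \<longrightarrow> d \<in> carrier D \<and> (d, c) \<in> T" unfolding \<T>_def by blast
    then show thesis using that by metis
  qed
  have slice_sub: "subgroup (slice T) D" if "T \<in> \<F>" for T
  proof -
    interpret T: subgroup T "D \<times>\<times> C" using sub[OF that] .
    show ?thesis
    proof (rule D.subgroupI)
      show "slice T \<noteq> {}" using T.one_closed unfolding slice_def by auto
      show "inv\<^bsub>D\<^esub> a \<in> slice T" if "a \<in> slice T" for a
      proof -
        have a: "a \<in> carrier D" "(a, \<one>\<^bsub>C\<^esub>) \<in> T" using that unfolding slice_def by auto
        have "inv\<^bsub>D \<times>\<times> C\<^esub> (a, \<one>\<^bsub>C\<^esub>) = (inv\<^bsub>D\<^esub> a, \<one>\<^bsub>C\<^esub>)"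
          using inv_DirProd[OF D.is_group C(1) a(1) C.one_closed] by simp
        then show ?thesis using T.m_inv_closed[OF a(2)] a unfolding slice_def by simp
      qed
      show "a \<otimes>\<^bsub>D\<^esub> b \<in> slice T" if "a \<in> slice T" "b \<in> slice T" for a b
        using T.m_closed[of "(a, \<one>\<^bsub>C\<^esub>)" "(b, \<one>\<^bsub>C\<^esub>)"] that unfolding slice_def by auto
    qed (auto simp: slice_def)
  qed
  have "carrier D \<in> slice ` \<T>"
  proof (rule divisible_group_coset_cover[OF D, where P = "(\<lambda>T. (s T, slice T)) ` \<T>"])
    show "carrier D \<subseteq> (\<Union>(a, H)\<in>(\<lambda>T. (s T, slice T)) ` \<T>. H #>\<^bsub>D\<^esub> a)"
    proof
      fix d assume d: "d \<in> carrier D"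
      then have "(d, c) \<in> carrier (D \<times>\<times> C)" using c by simp
      then obtain T where T: "T \<in> \<F>" "(d, c) \<in> T"
        using cover unfolding finite_proper_cover_def by blast
      then have T': "T \<in> \<T>" using d unfolding \<T>_def by blast
      interpret T: subgroup T "D \<times>\<times> C" using sub[OF T(1)] .
      have "(d, c) \<otimes>\<^bsub>D \<times>\<times> C\<^esub> inv\<^bsub>D \<times>\<times> C\<^esub> (s T, c) \<in> T"
        using T s[OF T'] by blast
      then have "d \<otimes>\<^bsub>D\<^esub> inv\<^bsub>D\<^esub> (s T) \<in> slice T"
        using s[OF T'] d c D.is_group C unfolding slice_def by simp
      moreover have "d = (d \<otimes>\<^bsub>D\<^esub> inv\<^bsub>D\<^esub> (s T)) \<otimes>\<^bsub>D\<^esub> s T"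
        using s[OF T'] d by (simp add: D.m_assoc)
      ultimately have "d \<in> slice T #>\<^bsub>D\<^esub> s T" unfolding r_coset_def by blast
      then show "d \<in> (\<Union>(a, H)\<in>(\<lambda>T. (s T, slice T)) ` \<T>. H #>\<^bsub>D\<^esub> a)" using T' by auto
    qed
  qed (use fin s slice_sub in \<open>auto simp: \<T>_def\<close>)
  then obtain T where T: "T \<in> \<T>" "carrier D = slice T" by blast
  then have T\<F>: "T \<in> \<F>" unfolding \<T>_def by simp
  interpret T: subgroup T "D \<times>\<times> C" using sub[OF T\<F>] .
  have D1: "(d, \<one>\<^bsub>C\<^esub>) \<in> T" if "d \<in> carrier D" for d
  proof -
    have "d \<in> slice T" using that T(2) by blast
    then show ?thesis unfolding slice_def by blast
  qed
  have "(inv\<^bsub>D\<^esub> s T, \<one>\<^bsub>C\<^esub>) \<otimes>\<^bsub>D \<times>\<times> C\<^esub> (s T, c) \<in> T"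
    using s[OF T(1)] D1 T.m_closed D.inv_closed by blast
  then have c1: "(\<one>\<^bsub>D\<^esub>, c) \<in> T" using s[OF T(1)] c by simp
  have ck: "(\<one>\<^bsub>D\<^esub>, c [^]\<^bsub>C\<^esub> k) \<in> T" for k :: int
  proof -
    interpret i: group_hom C "D \<times>\<times> C" "\<lambda>x. (\<one>\<^bsub>D\<^esub>, x)"
      by (auto simp: group_hom_def group_hom_axioms_def hom_def DC.is_group C)
    have "(\<one>\<^bsub>D\<^esub>, c) [^]\<^bsub>D \<times>\<times> C\<^esub> k \<in> T"
      using c1 sub[OF T\<F>] DC.subgroup_int_pow_closed by blast
    then show ?thesis using i.hom_int_pow[OF c(1)] by simp
  qed
  have "carrier (D \<times>\<times> C) \<subseteq> T"
  proof (clarsimp)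
    fix d x assume d: "d \<in> carrier D" "x \<in> carrier C"
    then obtain k :: int where "x = c [^]\<^bsub>C\<^esub> k" using c by auto
    then show "(d, x) \<in> T"
      using T.m_closed[OF D1[OF d(1)] ck[of k]] d by simp
  qed
  then have "T = carrier (D \<times>\<times> C)" using T.subset by blast
  then show False using T\<F> cover unfolding finite_proper_cover_def by blast
qed

section \<open>Elementary abelian groups\<close>

lemma prime_inverse_mod:
  fixes p :: nat and k :: int
  assumes "Factorial_Ring.prime p" "\<not> int p dvd k"
  obtains u :: int where "int p dvd k * u - 1"
proof -
  have "coprime (int p) k"
    using assms by (intro prime_imp_coprime_int) auto
  then obtain u v where "u * int p + v * k = 1"
    using bezout_int[of "int p" k] by auto
  then have "k * v - 1 = int p * (- u)" by (simp add: algebra_simps)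
  then have "int p dvd k * v - 1" by simp
  then show thesis by (rule that)
qed

lemma (in group) int_pow_cong_exponent:
  fixes i j :: int
  assumes "x \<in> carrier G" "x [^] (p::nat) = \<one>" "int p dvd i - j"
  shows "x [^] i = x [^] j"
proof -
  obtain q where "i = j + int p * q" using assms(3) by (metis dvdE add_diff_cancel_left' diff_add_cancel add.commute)
  moreover have "x [^] (int p * q) = \<one>"
    using assms by (simp add: int_pow_int flip: int_pow_pow)
  ultimately show ?thesis using assms by (simp add: int_pow_mult)
qed

text \<open>
  View \<open>G\<close> as a vector space over the field with \<open>p\<close> elements, in which \<open>b\<close> and \<open>c\<close> are linearly
  independent. A complement \<open>W\<close> of their span, which comes from Zorn's lemma because \<open>G\<close> may have
  infinite dimension, makes \<open>G/W\<close> a plane. The cover consists of the preimages in \<open>G\<close> of the \<open>p + 1\<close>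
  lines of this plane, spanned by \<open>b\<close> and by \<open>c + t b\<close> for \<open>0 \<le> t < p\<close>.
\<close>

lemma (in comm_group) elementary_abelian_cover:
  fixes p :: nat
  assumes p: "Factorial_Ring.prime p" and exp: "\<And>x. x \<in> carrier G \<Longrightarrow> x [^] p = \<one>"
    and b: "b \<in> carrier G" "b \<noteq> \<one>"
    and c: "c \<in> carrier G" "c \<notin> range (\<lambda>k::int. b [^] k)"
  shows "\<exists>\<F>. finite_proper_cover G \<F>"
proof -
  define powers where "powers x = range (\<lambda>k::int. x [^] k)" for x
  have powers_sub: "subgroup (powers x) G" if "x \<in> carrier G" for x
    using subgroup_of_powers[OF that] powers_def by simp
  have invert: "\<exists>u::int. \<forall>x\<in>carrier G. x [^] (k * u) = x" if "\<not> int p dvd k" for k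
    using prime_inverse_mod[OF p that] int_pow_cong_exponent[OF _ exp, of _ _ 1] int_pow_1
    by metis
  have indep: "b [^] i = \<one> \<and> c [^] j = \<one>" if eq: "b [^] i \<otimes> c [^] j = \<one>" for i j :: int
  proof -
    have "int p dvd j"
    proof (rule ccontr)
      assume "\<not> int p dvd j"
      then obtain u where u: "\<forall>x\<in>carrier G. x [^] (j * u) = x" using invert by blast
      have "c [^] j = b [^] (- i)"
        using eq b c by (metis int_pow_closed int_pow_neg inv_equality inv_inv m_comm)
      then have "c = b [^] (- i * u)"
        using u b c by (metis int_pow_pow)
      then show False using c by blast
    qed
    then have "c [^] j = \<one>" using int_pow_cong_exponent[OF c(1) exp, of j 0] c by simp
    then show ?thesis using eq b c by simp
  qed
  \<comment> \<open>The subgroups that meet the span of \<open>b\<close> and \<open>c\<close> trivially.\<close>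
  define \<W> where "\<W> = {W. subgroup W G \<and> (\<forall>(i::int) (j::int). b [^] i \<otimes> c [^] j \<in> W \<longrightarrow> b [^] i \<otimes> c [^] j = \<one>)}"
  have "\<exists>W\<in>\<W>. \<forall>V\<in>\<W>. W \<subseteq> V \<longrightarrow> V = W"
  proof (rule subset_Zorn_nonempty)
    have "{\<one>} \<in> \<W>" unfolding \<W>_def using triv_subgroup by auto
    then show "\<W> \<noteq> {}" by blast
    fix \<C> assume \<C>: "\<C> \<noteq> {}" "subset.chain \<W> \<C>"
    then have in\<W>: "\<And>V. V \<in> \<C> \<Longrightarrow> V \<in> \<W>" and lin: "\<And>V Y. V \<in> \<C> \<Longrightarrow> Y \<in> \<C> \<Longrightarrow> V \<subseteq> Y \<or> Y \<subseteq> V"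
      unfolding subset_chain_def by auto
    have subC: "\<And>V. V \<in> \<C> \<Longrightarrow> subgroup V G" using in\<W> \<W>_def by blast
    have "subgroup (\<Union>\<C>) G"
    proof (rule subgroupI)
      show "\<Union>\<C> \<subseteq> carrier G" using subC subgroup.subset by blast
      show "\<Union>\<C> \<noteq> {}" using \<C>(1) subC subgroup.one_closed by blast
      show "inv x \<in> \<Union>\<C>" if "x \<in> \<Union>\<C>" for x
        using that subC subgroup.m_inv_closed by fast
      show "x \<otimes> y \<in> \<Union>\<C>" if xy: "x \<in> \<Union>\<C>" "y \<in> \<Union>\<C>" for x y
      proof -
        obtain U V where UV: "U \<in> \<C>" "x \<in> U" "V \<in> \<C>" "y \<in> V" using xy by blast
        then have "U \<union> V \<in> \<C>" using lin by (metis sup.absorb1 sup.absorb2)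
        moreover have "x \<otimes> y \<in> U \<union> V"
          using calculation subC UV by (intro subgroup.m_closed) auto
        ultimately show ?thesis by blast
      qed
    qed
    then show "\<Union>\<C> \<in> \<W>" using in\<W> unfolding \<W>_def by blast
  qed
  then obtain W where W\<W>: "W \<in> \<W>" and max: "\<And>V. V \<in> \<W> \<Longrightarrow> W \<subseteq> V \<Longrightarrow> V = W" by blast
  have W: "subgroup W G" and triv: "\<And>(i::int) (j::int). b [^] i \<otimes> c [^] j \<in> W \<Longrightarrow> b [^] i \<otimes> c [^] j = \<one>"
    using W\<W> unfolding \<W>_def by auto
  interpret W: subgroup W G by fact
  \<comment> \<open>If \<open>x\<close> is not in \<open>W\<close>, then adjoining it to \<open>W\<close> creates a nontrivial element of the span of
      \<open>b\<close> and \<open>c\<close>. It involves \<open>x\<close> with an exponent prime to \<open>p\<close>, so it can be solved for \<open>x\<close>.\<close>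
  have span: "\<exists>w\<in>W. \<exists>(i::int) (j::int). x = w \<otimes> (b [^] i \<otimes> c [^] j)" if x: "x \<in> carrier G" for x
  proof (cases "x \<in> W")
    case True
    then have "x = x \<otimes> (b [^] (0::int) \<otimes> c [^] (0::int))" using x by simp
    then show ?thesis using True by blast
  next
    case False
    let ?V = "W <#> powers x"
    have V: "subgroup ?V G" using mult_subgroups[OF W powers_sub[OF x]] .
    have "w \<in> ?V" if "w \<in> W" for w
    proof -
      have "w = w \<otimes> x [^] (0::int)" using that by simp
      then show ?thesis unfolding set_mult_def powers_def using that by blast
    qed
    moreover have "x \<in> ?V"
    proof -
      have "x = \<one> \<otimes> x [^] (1::int)" using x by simp
      then show ?thesis unfolding set_mult_def powers_def using W.one_closed by blast
    qed
    ultimately have "?V \<notin> \<W>" using max False by blast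
    then obtain i j where ij: "b [^] (i::int) \<otimes> c [^] (j::int) \<in> ?V" "b [^] i \<otimes> c [^] j \<noteq> \<one>"
      using V unfolding \<W>_def by blast
    then obtain w k where w: "w \<in> W" "b [^] i \<otimes> c [^] j = w \<otimes> x [^] (k::int)"
      unfolding set_mult_def powers_def by blast
    have "\<not> int p dvd k"
    proof
      assume "int p dvd k"
      then have "x [^] k = \<one>" using int_pow_cong_exponent[OF x exp[OF x], of k 0] by simp
      then have "b [^] i \<otimes> c [^] j = w" using w W.mem_carrier by simp
      then show False using w(1) triv ij(2) by metis
    qed
    then obtain u where u: "\<forall>x\<in>carrier G. x [^] (k * u) = x" using invert by blast
    have "b [^] (i * u) \<otimes> c [^] (j * u) = (b [^] i \<otimes> c [^] j) [^] u"
      using b c by (simp add: int_pow_distrib int_pow_pow)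
    also have "\<dots> = w [^] u \<otimes> x"
      using w x u by (simp add: int_pow_distrib int_pow_pow)
    finally have "x = inv (w [^] u) \<otimes> (b [^] (i * u) \<otimes> c [^] (j * u))"
      using w x b c by (simp add: inv_solve_left)
    moreover have "inv (w [^] u) \<in> W"
      using w W subgroup_int_pow_closed by blast
    ultimately show ?thesis by blast
  qed
  let ?line = "\<lambda>x. W <#> powers x"
  let ?\<F> = "insert (?line b) ((\<lambda>t. ?line (c \<otimes> b [^] t)) ` {0..<int p})"
  have p0: "int p > 0" using p prime_gt_0_nat by simp
  have "c \<notin> ?line b"
  proof
    assume "c \<in> ?line b"
    then obtain w k where w: "w \<in> W" "c = w \<otimes> b [^] (k::int)"
      unfolding set_mult_def powers_def by blast
    then have "b [^] (- k) \<otimes> c [^] (1::int) = w"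
      using b c w(1) W.mem_carrier by (simp add: int_pow_neg inv_solve_left' m_comm)
    then have "c [^] (1::int) = \<one>" using w triv indep by metis
    then have "c = b [^] (0::int)" using c by simp
    then show False using c by blast
  qed
  moreover have "b \<notin> ?line (c \<otimes> b [^] (t::int))" for t
  proof
    assume "b \<in> ?line (c \<otimes> b [^] t)"
    then obtain w k where w: "w \<in> W" "b = w \<otimes> (c \<otimes> b [^] t) [^] (k::int)"
      unfolding set_mult_def powers_def by blast
    have "b [^] (1 - t * k) \<otimes> c [^] (- k) = b \<otimes> inv ((c \<otimes> b [^] t) [^] k)"
      using b c by (simp add: int_pow_diff int_pow_neg int_pow_distrib int_pow_pow inv_mult m_ac)
    also have "\<dots> = w"
      using w b c W.mem_carrier by (metis int_pow_closed inv_solve_right' m_closed)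
    finally have "b [^] (1 - t * k) \<otimes> c [^] (- k) = w" .
    then have one: "b [^] (1 - t * k) = \<one>" "c [^] (- k) = \<one>" using w triv indep by metis+
    have "int p dvd k"
    proof (rule ccontr)
      assume "\<not> int p dvd k"
      then obtain u where u: "\<forall>x\<in>carrier G. x [^] (k * u) = x" using invert by blast
      have "c = (c [^] (- k)) [^] (- u)" using u c by (simp add: int_pow_pow)
      then have "c = b [^] (0::int)" using one by simp
      then show False using c by blast
    qed
    then have "b [^] (1 - t * k) = b [^] (1::int)"
      using b by (intro int_pow_cong_exponent[OF _ exp]) auto
    then show False using one b by simp
  qed
  ultimately have proper: "\<forall>H\<in>?\<F>. H \<noteq> carrier G" using b c by blast
  have subF: "\<forall>H\<in>?\<F>. subgroup H G" using mult_subgroups[OF W powers_sub] b c by auto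
  have "carrier G \<subseteq> \<Union>?\<F>"
  proof
    fix x assume x: "x \<in> carrier G"
    obtain w i j where w: "w \<in> W" "x = w \<otimes> (b [^] (i::int) \<otimes> c [^] (j::int))"
      using span[OF x] by blast
    show "x \<in> \<Union>?\<F>"
    proof (cases "int p dvd j")
      case True
      then have "c [^] j = \<one>" using int_pow_cong_exponent[OF c(1) exp, of j 0] c by simp
      then have "x = w \<otimes> b [^] i" using w b by simp
      then have "x \<in> ?line b" unfolding set_mult_def powers_def using w by blast
      then show ?thesis by blast
    next
      case False
      then obtain u where u: "\<forall>x\<in>carrier G. x [^] (j * u) = x" using invert by blast
      \<comment> \<open>With \<open>u\<close> inverse to \<open>j\<close> modulo \<open>p\<close>, the vector \<open>i b + j c\<close> is \<open>j (c + i u b)\<close>.\<close>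
      define t where "t = (i * u) mod int p"
      have "b [^] (t * j) = b [^] i"
      proof -
        have "b [^] t = b [^] (i * u)" unfolding t_def
          using b by (intro int_pow_cong_exponent[OF _ exp]) (auto simp: mod_eq_dvd_iff[symmetric])
        then have "b [^] (t * j) = (b [^] i) [^] (j * u)"
          using b by (metis int_pow_pow mult.assoc mult.commute)
        then show ?thesis using u b by simp
      qed
      then have "(c \<otimes> b [^] t) [^] j = b [^] i \<otimes> c [^] j"
        using b c by (simp add: int_pow_distrib int_pow_pow m_comm)
      then have "x = w \<otimes> (c \<otimes> b [^] t) [^] j" using w by simp
      then have "x \<in> ?line (c \<otimes> b [^] t)" unfolding set_mult_def powers_def using w by blast
      moreover have "t \<in> {0..<int p}" using p0 unfolding t_def by simp
      ultimately show ?thesis by blast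
    qed
  qed
  then have "finite_proper_cover G ?\<F>" unfolding finite_proper_cover_def using proper subF by simp
  then show ?thesis by blast
qed

section \<open>Groups without such a cover\<close>

lemma (in comm_group) subgroup_of_nat_powers:
  "subgroup ((\<lambda>x. x [^] (n::nat)) ` carrier G) G"
proof -
  interpret group_hom G G "\<lambda>x. x [^] n"
    by unfold_locales (auto simp: hom_def nat_pow_distrib)
  show ?thesis by (rule img_is_subgroup)
qed

text \<open>
  If \<open>x\<close> were outside \<open>\<langle>b\<rangle> G^p\<close>, the classes of \<open>b\<close> and \<open>x\<close> in the elementary abelian group
  \<open>G/G^p\<close> would yield a finite cover of it by proper subgroups, and the preimages would cover \<open>G\<close>.
\<close>

lemma (in comm_group) prime_quotient_cyclic:
  fixes p :: nat
  assumes nocover: "\<nexists>\<F>. finite_proper_cover G \<F>" and p: "Factorial_Ring.prime p"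
    and b: "b \<in> carrier G" "b \<notin> (\<lambda>x. x [^] p) ` carrier G"
    and x: "x \<in> carrier G"
  shows "\<exists>k::int. \<exists>y\<in>carrier G. x = b [^] k \<otimes> y [^] p"
proof -
  define P where "P = (\<lambda>x. x [^] p) ` carrier G"
  have P: "subgroup P G" unfolding P_def by (rule subgroup_of_nat_powers)
  interpret P: normal P G using P subgroup_imp_normal by blast
  interpret Q: comm_group "G Mod P" using abelian_FactGroup[OF P] .
  interpret h: group_hom G "G Mod P" "\<lambda>a. P #> a"
    using P.r_coset_hom_Mod by unfold_locales
  have surj: "(\<lambda>a. P #> a) ` carrier G = carrier (G Mod P)" by (simp add: carrier_FactGroup)
  have nocoverQ: "\<nexists>\<F>. finite_proper_cover (G Mod P) \<F>"
    using h.finite_proper_cover_vimage[OF surj] nocover by blast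
  have "P #> x \<in> range (\<lambda>k::int. (P #> b) [^]\<^bsub>G Mod P\<^esub> k)"
  proof (rule ccontr)
    assume notin: "\<not> ?thesis"
    have "\<exists>\<F>. finite_proper_cover (G Mod P) \<F>"
    proof (rule Q.elementary_abelian_cover[OF p _ _ _ _ notin])
      fix V assume "V \<in> carrier (G Mod P)"
      then obtain a where a: "a \<in> carrier G" "V = P #> a" using surj by blast
      then have "V [^]\<^bsub>G Mod P\<^esub> p = P #> a [^] p" by (simp add: h.hom_nat_pow)
      moreover have "a [^] p \<in> P" unfolding P_def using a by blast
      ultimately show "V [^]\<^bsub>G Mod P\<^esub> p = \<one>\<^bsub>G Mod P\<^esub>"
        using P.rcos_const by simp
    next
      show "P #> b \<noteq> \<one>\<^bsub>G Mod P\<^esub>"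
        using rcos_self[OF b(1) P] b(2) unfolding P_def by auto
    qed (use b x in auto)
    then show False using nocoverQ by blast
  qed
  then obtain k :: int where "P #> x = P #> b [^] k" using b by (auto simp: h.hom_int_pow)
  then have "x \<in> P #> b [^] k" using rcos_self[OF x P] by simp
  then obtain y where "y \<in> carrier G" "x = y [^] p \<otimes> b [^] k"
    unfolding r_coset_def P_def by blast
  then show ?thesis using b by (metis int_pow_closed m_comm nat_pow_closed)
qed

text \<open>
  The subgroups \<open>G^p\<close> with \<open>p \<le> N\<close> that are proper do not cover \<open>G\<close>; the element \<open>b\<close> is chosen
  outside all of them. It then generates \<open>G\<close> modulo \<open>G^p\<close> for every prime \<open>p \<le> N\<close>, trivially so if
  \<open>G^p = G\<close>. Composite exponents follow by substitution: from \<open>x = b^k y^p\<close> and \<open>y = b^l z^m\<close> one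
  obtains \<open>x = b^(k + l p) z^(p m)\<close>.
\<close>

lemma (in comm_group) cyclic_modulo_powers:
  fixes N :: nat
  assumes nocover: "\<nexists>\<F>. finite_proper_cover G \<F>"
  obtains b where "b \<in> carrier G"
    and "\<And>n x. \<lbrakk>0 < n; n \<le> N; x \<in> carrier G\<rbrakk> \<Longrightarrow> \<exists>k::int. \<exists>y\<in>carrier G. x = b [^] k \<otimes> y [^] n"
proof -
  let ?P = "\<lambda>p. (\<lambda>x. x [^] (p::nat)) ` carrier G"
  let ?\<F> = "?P ` {p. p \<le> N \<and> ?P p \<noteq> carrier G}"
  have "\<not> finite_proper_cover G ?\<F>" using nocover by blast
  moreover have "finite ?\<F>" by simp
  moreover have "\<forall>H\<in>?\<F>. subgroup H G \<and> H \<noteq> carrier G" using subgroup_of_nat_powers by auto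
  ultimately obtain b where b: "b \<in> carrier G" "b \<notin> \<Union>?\<F>"
    unfolding finite_proper_cover_def by blast
  have prime_case: "\<exists>k::int. \<exists>y\<in>carrier G. x = b [^] k \<otimes> y [^] p"
    if p: "Factorial_Ring.prime p" "p \<le> N" and x: "x \<in> carrier G" for p x
  proof (cases "?P p = carrier G")
    case True
    then obtain y where "y \<in> carrier G" "x = y [^] p" using x by blast
    then have "x = b [^] (0::int) \<otimes> y [^] p" by simp
    then show ?thesis using \<open>y \<in> carrier G\<close> by blast
  next
    case False
    then have "b \<notin> ?P p" using b p by blast
    then show ?thesis using prime_quotient_cyclic[OF nocover p(1) b(1)] x by blast
  qed
  have "\<exists>k::int. \<exists>y\<in>carrier G. x = b [^] k \<otimes> y [^] n"
    if "0 < n" "n \<le> N" "x \<in> carrier G" for n x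
    using that
  proof (induction n arbitrary: x rule: less_induct)
    case (less n)
    show ?case
    proof (cases "n = 1")
      case True
      have "x = b [^] (0::int) \<otimes> x [^] (1::nat)" using less by simp
      then show ?thesis using True less by blast
    next
      case False
      then obtain p where p: "Factorial_Ring.prime p" "p dvd n" using prime_factor_nat by blast
      then obtain m where m: "n = p * m" by (elim dvdE)
      have "m > 0" "m < n" using m less.prems(1) prime_gt_1_nat[OF p(1)] by auto
      have "p \<le> N" using p less.prems by (meson dvd_imp_le order_trans)
      then obtain k :: int and y where y: "y \<in> carrier G" "x = b [^] k \<otimes> y [^] p"
        using prime_case p less.prems by blast
      obtain l :: int and z where z: "z \<in> carrier G" "y = b [^] l \<otimes> z [^] m"
        using less.IH[of m y] \<open>m > 0\<close> \<open>m < n\<close> less.prems y by auto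
      have "y [^] p = b [^] (l * int p) \<otimes> z [^] n"
        using b z m by (simp add: nat_pow_distrib nat_pow_pow mult.commute[of m])
          (simp add: int_pow_pow flip: int_pow_int)
      then have "x = b [^] (k + l * int p) \<otimes> z [^] n"
        using y z b by (simp add: int_pow_mult m_assoc)
      then show ?thesis using z by blast
    qed
  qed
  then show thesis using that b by blast
qed

section \<open>Splitting off the divisible part\<close>

text \<open>
  The summands of \<open>divisible_plus_finite_cyclic\<close> are plain monoid records, without the extension
  fields that \<open>G\<close> may carry; this is why a subgroup is made into such a record by hand.
\<close>

lemma (in comm_group) subgroup_monoid:
  assumes H: "subgroup H G"
  defines "H' \<equiv> \<lparr>carrier = H, monoid.mult = (\<otimes>), one = \<one>\<rparr>"
  shows "comm_group H'" and "\<And>x k::int. x \<in> H \<Longrightarrow> x [^]\<^bsub>H'\<^esub> k = x [^] k"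
proof -
  interpret H: subgroup H G by fact
  show H': "comm_group H'"
  proof (rule comm_groupI)
    show "\<exists>y\<in>carrier H'. y \<otimes>\<^bsub>H'\<^esub> x = \<one>\<^bsub>H'\<^esub>" if "x \<in> carrier H'" for x
      using that H.m_inv_closed H.mem_carrier by (intro bexI[of _ "inv x"]) (auto simp: H'_def)
  qed (auto simp: H'_def m_ac)
  interpret H': comm_group H' by fact
  interpret group_hom H' G "\<lambda>x. x"
    by unfold_locales (auto simp: hom_def H'_def)
  show "x [^]\<^bsub>H'\<^esub> k = x [^] k" if "x \<in> H" for x and k :: int
    using hom_int_pow[of x k] that by (simp add: H'_def)
qed

text \<open>
  The quotient by \<open>D\<close> is cyclic of finite order \<open>m\<close>, generated by \<open>b\<close>. Divisibility of \<open>D\<close> allows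
  \<open>b\<close> to be changed within its coset to an element \<open>c\<close> with \<open>c^m = 1\<close>, and \<open>\<langle>c\<rangle>\<close> is then a complement
  of \<open>D\<close>: a power of \<open>c\<close> in \<open>D\<close> has its exponent divisible by \<open>m\<close>, as \<open>b\<close> and \<open>c\<close> agree modulo \<open>D\<close>.
\<close>

lemma (in comm_group) divisible_plus_finite_cyclicI:
  fixes N :: nat
  assumes D: "subgroup D G"
    and div: "\<And>x n::nat. \<lbrakk>x \<in> D; 0 < n\<rbrakk> \<Longrightarrow> \<exists>y\<in>D. y [^] n = x"
    and b: "b \<in> carrier G" and N: "0 < N" "b [^] N \<in> D"
    and span: "\<And>x. x \<in> carrier G \<Longrightarrow> \<exists>k::int. \<exists>d\<in>D. x = b [^] k \<otimes> d"
  shows "divisible_plus_finite_cyclic G"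
proof -
  interpret D: subgroup D G by fact
  define m where "m = (LEAST m::nat. 0 < m \<and> b [^] m \<in> D)"
  have m: "0 < m" "b [^] m \<in> D"
    using LeastI[of "\<lambda>m::nat. 0 < m \<and> b [^] m \<in> D" N] N unfolding m_def by auto
  have least: "m \<le> n" if "0 < n" "b [^] n \<in> D" for n :: nat
    using that unfolding m_def by (intro Least_le) auto
  obtain d where d: "d \<in> D" "d [^] m = b [^] m" using div[OF m(2,1)] by blast
  define c where "c = b \<otimes> inv d"
  have dc: "d \<in> carrier G" using d by simp
  have c: "c \<in> carrier G" using b dc unfolding c_def by simp
  have cm: "c [^] m = \<one>"
    using b dc d(2) by (simp add: c_def nat_pow_distrib nat_pow_inv)
  have bc: "b [^] k = c [^] k \<otimes> d [^] k" for k :: int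
    using b dc by (simp add: c_def int_pow_distrib[symmetric] m_assoc)
  have dk: "d [^] k \<in> D" for k :: int using d D subgroup_int_pow_closed by blast
  define C where "C = range (\<lambda>k::int. c [^] k)"
  have C: "subgroup C G" unfolding C_def by (rule subgroup_of_powers[OF c])
  have reduce: "c [^] k = c [^] (k mod int m)" for k :: int
    using c cm by (intro int_pow_cong_exponent) (auto simp: mod_eq_dvd_iff[symmetric])
  have "c [^] k = \<one>" if "c [^] k \<in> D" for k :: int
  proof -
    define r where "r = nat (k mod int m)"
    have r: "int r = k mod int m" "r < m" using m(1) unfolding r_def by (auto simp: nat_less_iff)
    have "c [^] (int r) \<in> D" using that reduce[of k] r by simp
    then have "b [^] r \<in> D" using bc[of "int r"] dk[of "int r"] by (simp add: int_pow_int)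
    then have "r = 0" using least[of r] r(2) by (cases "r = 0") auto
    then show ?thesis using reduce[of k] r(1) by simp
  qed
  then have inter: "D \<inter> C \<subseteq> {\<one>}" unfolding C_def by blast
  have "carrier G \<subseteq> D <#> C"
  proof
    fix x assume x: "x \<in> carrier G"
    then obtain k :: int and e where e: "e \<in> D" "x = b [^] k \<otimes> e" using span by blast
    then have "x = (d [^] k \<otimes> e) \<otimes> c [^] k"
      using c dc D.mem_carrier by (simp add: bc m_ac)
    moreover have "d [^] k \<otimes> e \<in> D" using dk e by simp
    ultimately show "x \<in> D <#> C" unfolding set_mult_def C_def by blast
  qed
  then have sum: "D <#> C = carrier G"
    using setmult_subset_G[OF D.subset subgroup.subset[OF C]] by blast
  let ?D = "\<lparr>carrier = D, monoid.mult = (\<otimes>), one = \<one>\<rparr>"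
  let ?C = "\<lparr>carrier = C, monoid.mult = (\<otimes>), one = \<one>\<rparr>"
  have "divisible_group ?D"
    unfolding divisible_group_def using subgroup_monoid(1)[OF D] div by (simp add: nat_pow_def)
  moreover have groupC: "group ?C" using subgroup_monoid(1)[OF C] by (simp add: comm_group_def)
  moreover have "cyclic_group ?C"
  proof -
    have "c \<in> C" unfolding C_def using c int_pow_1 by (metis rangeI)
    moreover have "C = range (\<lambda>k::int. c [^]\<^bsub>?C\<^esub> k)"
      using subgroup_monoid(2)[OF C \<open>c \<in> C\<close>] by (simp add: C_def)
    ultimately show ?thesis
      unfolding group.cyclic_group[OF groupC] by auto
  qed
  moreover have "C \<subseteq> (\<lambda>k. c [^] k) ` {0..<int m}"
    unfolding C_def using reduce m(1) by auto (metis atLeastLessThan_iff image_eqI of_nat_0_less_iff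
        pos_mod_bound pos_mod_sign)
  then have "finite (carrier ?C)" by (simp add: finite_subset)
  moreover have "G \<cong> ?D \<times>\<times> ?C"
  proof -
    interpret group_disjoint_sum G D C
      by (simp add: group_disjoint_sum_def is_group D C)
    have "?D \<times>\<times> ?C = subgroup_generated G D \<times>\<times> subgroup_generated G C"
      using D C by (simp add: DirProd_def subgroup.carrier_subgroup_generated_subgroup)
    then have "?D \<times>\<times> ?C \<cong> G"
      using iso_group_mul[OF comm_group_axioms] inter sum by (auto intro: is_isoI)
    then show ?thesis
      using group.iso_sym DirProd_group group_subgroup_generated
        \<open>?D \<times>\<times> ?C = subgroup_generated G D \<times>\<times> subgroup_generated G C\<close> by metis
  qed
  ultimately show ?thesis unfolding divisible_plus_finite_cyclic_def by blast
qed

section \<open>The additive group of an Artinian ring\<close>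

lemma (in nonunital_ring) left_ideal_multiples:
  "left_ideal ((\<lambda>x. [(n::nat)] \<cdot> x) ` carrier R) R"
proof -
  have "r \<otimes> ([n] \<cdot> x) = [n] \<cdot> (r \<otimes> x)" if r: "r \<in> carrier R" and x: "x \<in> carrier R" for r x
  proof -
    interpret group_hom "add_monoid R" "add_monoid R" "\<lambda>x. r \<otimes> x"
      by unfold_locales (auto simp: hom_def r m_closed r_distr)
    show ?thesis using hom_nat_pow[of x n] x by (simp add: add_pow_def)
  qed
  then show ?thesis
    using add.subgroup_of_nat_powers[of n] m_closed
    unfolding left_ideal_def additive_subgroup_def by auto
qed

text \<open>
  The descending chain of the left ideals \<open>n! R\<close> becomes constant at some \<open>K! R\<close>. This group is
  divisible by \<open>n\<close>, because \<open>K! R = (K + n)! R\<close> and \<open>(K + n)!\<close> is a multiple of \<open>n K!\<close>.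
\<close>

lemma (in artinian_ring) multiples_divisible:
  obtains N :: nat where "0 < N"
    and "\<And>x n::nat. \<lbrakk>x \<in> (\<lambda>x. [N] \<cdot> x) ` carrier R; 0 < n\<rbrakk>
           \<Longrightarrow> \<exists>y\<in>(\<lambda>x. [N] \<cdot> x) ` carrier R. [n] \<cdot> y = x"
proof -
  define I where "I n = (\<lambda>x. [(fact n :: nat)] \<cdot> x) ` carrier R" for n :: nat
  have mult: "[(n * m :: nat)] \<cdot> x = [n] \<cdot> ([m] \<cdot> x)" if "x \<in> carrier R" for m n :: nat and x
    using add.nat_pow_pow[of x n m] that by (simp add: mult.commute)
  have closed: "[n] \<cdot> x \<in> carrier R" if "x \<in> carrier R" for n :: nat and x
    using add.nat_pow_closed[of x n] that by simp
  have "I (Suc n) \<subseteq> I n" for n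
  proof -
    have "(fact (Suc n) :: nat) = fact n * Suc n" by simp
    then show ?thesis unfolding I_def using mult closed by (metis (no_types, lifting) image_eqI image_subsetI)
  qed
  then obtain K where K: "\<And>n. n \<ge> K \<Longrightarrow> I n = I K"
    using descending_chain_condition[of I] left_ideal_multiples unfolding I_def by blast
  have "\<exists>y\<in>I K. [n] \<cdot> y = x" if x: "x \<in> I K" and n: "0 < n" for x and n :: nat
  proof -
    obtain z where z: "z \<in> carrier R" "x = [(fact (K + n) :: nat)] \<cdot> z"
      using K[of "K + n"] x unfolding I_def by auto
    have "fact K * n dvd (fact K * fact n :: nat)"
      using n by (intro mult_dvd_mono[OF dvd_refl] dvd_fact) auto
    also have "\<dots> dvd fact (K + n)" by (rule fact_fact_dvd_fact)
    finally obtain q where "fact (K + n) = fact K * n * q" by (elim dvdE)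
    then have "fact (K + n) = n * (fact K * q)" by (simp add: mult_ac)
    then have "x = [n] \<cdot> ([(fact K :: nat)] \<cdot> ([q] \<cdot> z))"
      using z mult closed by metis
    then show ?thesis using z closed unfolding I_def by blast
  qed
  then show thesis using that[of "fact K"] unfolding I_def by simp
qed

theorem theorem1:
  fixes A :: "('a, 'b) ring_scheme"
  assumes "artinian_ring A"
  shows "\<not> proper_union_of_additive_subgroups A \<longleftrightarrow> divisible_plus_finite_cyclic (add_monoid A)"
proof -
  interpret artinian_ring A by fact
  have "divisible_plus_finite_cyclic (add_monoid A)"
    if nocover: "\<nexists>\<F>. finite_proper_cover (add_monoid A) \<F>"
  proof -
    obtain N :: nat where N: "0 < N"
      and div: "\<And>x n::nat. \<lbrakk>x \<in> add_pow A N ` carrier A; 0 < n\<rbrakk>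
           \<Longrightarrow> \<exists>y\<in>add_pow A N ` carrier A. add_pow A n y = x"
      using multiples_divisible by blast
    obtain b where b: "b \<in> carrier A"
      and span: "\<And>n x. \<lbrakk>0 < n; n \<le> N; x \<in> carrier A\<rbrakk>
           \<Longrightarrow> \<exists>k::int. \<exists>y\<in>carrier A. x = add_pow A k b \<oplus>\<^bsub>A\<^esub> add_pow A n y"
      by (rule add.cyclic_modulo_powers[OF nocover, of N]) simp
    show ?thesis
    proof (rule add.divisible_plus_finite_cyclicI[OF add.subgroup_of_nat_powers[of N] _ b N])
      show "\<exists>y\<in>add_pow A N ` carrier A. add_pow A n y = x"
        if "x \<in> add_pow A N ` carrier A" "0 < n" for x and n :: nat
        using that by (rule div)
      show "add_pow A N b \<in> add_pow A N ` carrier A" using b by (rule imageI)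
      show "\<exists>k::int. \<exists>d\<in>add_pow A N ` carrier A. x = add_pow A k b \<oplus>\<^bsub>A\<^esub> d"
        if "x \<in> carrier A" for x
        using span[OF N le_refl that] by blast
    qed
  qed
  moreover have "\<nexists>\<F>. finite_proper_cover (add_monoid A) \<F>"
    if split: "divisible_plus_finite_cyclic (add_monoid A)"
  proof -
    obtain D C :: "'a monoid" where D: "divisible_group D" and C: "group C" "cyclic_group C"
      and iso: "add_monoid A \<cong> D \<times>\<times> C"
      using split by (auto simp: divisible_plus_finite_cyclic_def)
    have DC: "group (D \<times>\<times> C)"
      using D C by (simp add: DirProd_group divisible_group_def comm_group_def)
    then have "D \<times>\<times> C \<cong> add_monoid A" using add.iso_sym iso by blast
    then obtain h where h: "h \<in> iso (D \<times>\<times> C) (add_monoid A)" unfolding is_iso_def by blast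
    interpret group_hom "D \<times>\<times> C" "add_monoid A" h
      using h DC add.is_group by (simp add: group_hom_def group_hom_axioms_def iso_def)
    show ?thesis
      using finite_proper_cover_vimage no_finite_proper_cover_divisible_times_cyclic[OF D C] h
      by (fastforce simp: iso_def bij_betw_def)
  qed
  ultimately show ?thesis
    using proper_union_iff_finite_proper_cover[OF add.is_group] by blast
qed

end
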